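(* Let $G$ be a connected weighted undirected graph on $n$ vertices with modularity matrix $M$ and degree vector $d$. Let $\lambda$ be an eigenvalue of $M$ and let $u\in\mathbb{R}^n$ be an associated eigenvector, oriented so that $d^T u\geq 0$. Let $\ell$ and $\ell'$ be respectively the number of eigenvalues of $M$ which are greater than or equal to $\lambda$ and the number of eigenvalues of $M$ which are strictly greater than $\lambda$, counted with their multiplicity. If at least two entries of $u$ have opposite signs, then $u$ induces at most $\ell+1$ positive strong nodal domains and at most $\ell'+1$ positive weak nodal domains.
   Context: A graph $G=(V,E,\omega)$, $V=\{1,\dots,n\}$, is finite, undirected, connected, without multiple edges (loops are allowed), with edge weights $\omega:E\to\mathbb{R}^+$. Its adjacency matrix $A=(a_{ij})$ is the symmetric matrix with $a_{ij}=\omega(ij)>0$ if $ij\in E$ and $a_{ij}=0$ otherwise. The (generalized) degree is $d_i=\sum_{j}a_{ij}$, $d=(d_1,\dots,d_n)^T$, and $\mathrm{vol}\,G=\sum_i d_i$. The modularity matrix is $M=A-\frac{1}{\mathrm{vol}\,G}dd^T$. Nodal domains: for $0\neq u\in\mathbb{R}^n$, a positive strong nodal domain induced by $u$ is the vertex set of a (maximal) connected component of the subgraph induced by $\{i:u_i>0\}$. A positive weak nodal domain induced by $u$ is the vertex set of a (maximal) connected component of the subgraph induced by $\{i:u_i\geq 0\}$ that contains at least one vertex $i$ with $u_i\neq 0$. "Opposite signs" means that one entry is strictly positive and another is strictly negative. *)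

theory Defs
  imports
    "Graph_Theory.Pair_Digraph"
    "Graph_Theory.Digraph_Component"
    "Graph_Theory.Weighted_Graph"
    "Jordan_Normal_Form.Char_Poly"
begin

text \<open>
  An undirected graph without multiple edges is a finite symmetric pair digraph: the edge
  \<open>ij\<close> is the pair of arcs \<open>(i,j)\<close>, \<open>(j,i)\<close>, which must carry the same weight; a loop is the
  single arc \<open>(i,i)\<close>. Vertices are numbered from 0 to match the indices of vectors and matrices.
  The weight function is unconstrained outside the arcs.
\<close>

locale connected_weighted_graph = pair_pseudo_graph G
  for G :: "nat pair_pre_digraph" +
  fixes n :: nat and \<omega> :: "(nat \<times> nat) weight_fun"
  assumes verts_eq: "pverts G = {0..<n}"
    and connected: "Digraph_Component.connected (with_proj G)"
    and weight_pos: "\<And>i j. (i, j) \<in> parcs G \<Longrightarrow> \<omega> (i, j) > 0"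
    and weight_sym: "\<And>i j. (i, j) \<in> parcs G \<Longrightarrow> \<omega> (i, j) = \<omega> (j, i)"

definition adjacency_mat ::
    "nat pair_pre_digraph \<Rightarrow> nat \<Rightarrow> (nat \<times> nat) weight_fun \<Rightarrow> real mat" where
  "adjacency_mat G n \<omega> = mat n n (\<lambda>(i, j). if (i, j) \<in> parcs G then \<omega> (i, j) else 0)"

text \<open>A loop contributes its weight once to the degree.\<close>

definition degree_vec ::
    "nat pair_pre_digraph \<Rightarrow> nat \<Rightarrow> (nat \<times> nat) weight_fun \<Rightarrow> real vec" where
  "degree_vec G n \<omega> = vec n (\<lambda>i. \<Sum>j<n. adjacency_mat G n \<omega> $$ (i, j))"

definition volume ::
    "nat pair_pre_digraph \<Rightarrow> nat \<Rightarrow> (nat \<times> nat) weight_fun \<Rightarrow> real" where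
  "volume G n \<omega> = (\<Sum>i<n. degree_vec G n \<omega> $ i)"

text \<open>
  The volume of a connected graph vanishes only for a single vertex without loop; division by
  zero then makes the modularity matrix the zero matrix.
\<close>

definition modularity_mat ::
    "nat pair_pre_digraph \<Rightarrow> nat \<Rightarrow> (nat \<times> nat) weight_fun \<Rightarrow> real mat" where
  "modularity_mat G n \<omega> = adjacency_mat G n \<omega>
     - (1 / volume G n \<omega>) \<cdot>\<^sub>m mat n n (\<lambda>(i, j). degree_vec G n \<omega> $ i * degree_vec G n \<omega> $ j)"

text \<open>
  Number of the real eigenvalues of \<open>A\<close> satisfying \<open>P\<close>, with their algebraic multiplicity. For
  the symmetric matrices considered here all eigenvalues are real, and algebraic and geometric
  multiplicities agree.
\<close>

definition count_eigenvalues :: "real mat \<Rightarrow> (real \<Rightarrow> bool) \<Rightarrow> nat" where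
  "count_eigenvalues A P = (\<Sum>\<mu> | eigenvalue A \<mu> \<and> P \<mu>. order \<mu> (char_poly A))"

definition components_verts :: "('a, 'b) pre_digraph \<Rightarrow> 'a set set" where
  "components_verts H = verts ` {C. pre_digraph.max_subgraph H Digraph_Component.connected C}"

definition positive_strong_nodal_domains ::
    "nat pair_pre_digraph \<Rightarrow> real vec \<Rightarrow> nat set set" where
  "positive_strong_nodal_domains G u =
     components_verts (with_proj G \<restriction> {i \<in> pverts G. u $ i > 0})"

definition positive_weak_nodal_domains ::
    "nat pair_pre_digraph \<Rightarrow> real vec \<Rightarrow> nat set set" where
  "positive_weak_nodal_domains G u =
     {D \<in> components_verts (with_proj G \<restriction> {i \<in> pverts G. u $ i \<ge> 0}). \<exists>i\<in>D. u $ i \<noteq> 0}"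

end

theory Submission
  imports Defs
begin

text \<open>
  Let \<open>A\<close> be the adjacency matrix, \<open>c = (d \<bullet> u) / vol G \<ge> 0\<close>, and let \<open>D\<^sub>1, \<dots>, D\<^sub>k\<close> be the nodal
  domains, strong or weak. The eigenvalue equation reads \<open>A u = \<lambda> u + c d\<close>. For a domain \<open>D\<close> let
  \<open>w\<^sub>D\<close> be \<open>u\<close> restricted to \<open>D\<close>. Since \<open>D\<close> is a component of the subgraph induced by
  \<open>S = {u > 0}\<close> (or \<open>{u \<ge> 0}\<close>), every neighbour of \<open>D\<close> outside \<open>D\<close> lies outside \<open>S\<close>, where
  \<open>u \<le> 0\<close>. Dropping these neighbours from \<open>A u\<close> can therefore only increase the value: on \<open>D\<close> one
  has \<open>A w\<^sub>D = \<lambda> w\<^sub>D + r\<^sub>D\<close> with \<open>r\<^sub>D \<ge> 0\<close>. Different domains are not adjacent, so the quadratic form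
  of \<open>A\<close> is at least \<open>\<lambda> \<parallel>v\<parallel>\<^sup>2\<close> on the \<open>k\<close>-dimensional span of the \<open>w\<^sub>D\<close>. The rank one correction
  that turns \<open>A\<close> into \<open>M\<close> vanishes on vectors orthogonal to \<open>d\<close>; this costs one dimension and is
  the origin of the \<open>+ 1\<close> in the bounds.

  If \<open>k > \<ell> + 1\<close>, a nonzero combination \<open>v\<close> of the \<open>w\<^sub>D\<close> is orthogonal to \<open>d\<close> and to all \<open>\<ell>\<close>
  eigenvectors of \<open>M\<close> with eigenvalue at least \<open>\<lambda>\<close>, so that its Rayleigh quotient is less than
  \<open>\<lambda>\<close>, a contradiction. If only \<open>k > \<ell>' + 1\<close> is known, the Rayleigh quotient is at most \<open>\<lambda>\<close>, hence
  equal to it, and then \<open>v\<close> is itself an eigenvector: \<open>M v = \<lambda> v\<close>. Comparing with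
  \<open>M v = \<lambda> v + \<alpha>\<^sub>D r\<^sub>D\<close> on a domain \<open>D\<close> with coefficient \<open>\<alpha>\<^sub>D \<noteq> 0\<close> gives \<open>r\<^sub>D = 0\<close>. But \<open>G\<close> is
  connected and \<open>u\<close> has a negative entry, so some edge leaves a weak domain \<open>D\<close>, necessarily
  towards a vertex with \<open>u < 0\<close>, and it contributes a positive amount to \<open>r\<^sub>D\<close>.

  The graph side rests on \<open>induced_component\<close> and \<open>arc_leaving\<close>. The spectral side is
  \<open>rayleigh_bound_on_large_span\<close>, which follows from the orthogonal diagonalization of real
  symmetric matrices (\<open>symmetric_mat_diagonalization\<close>). Both halves of the result are instances of
  \<open>nodal_domain_bound\<close>.
\<close>

section \<open>Components of induced subgraphs\<close>

text \<open>
  In a symmetric digraph weak and strong connectivity coincide, which makes the theory of strongly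
  connected components (disjointness, characterisation by reachability) available for components.
\<close>

lemma component_in_sccs_verts:
  assumes wf: "wf_digraph H" and sym: "symmetric H" and D: "D \<in> components_verts H"
  shows "D \<in> pre_digraph.sccs_verts H"
proof -
  interpret wf_digraph H by (rule wf)
  obtain C where C: "max_subgraph Digraph_Component.connected C" and DC: "D = verts C"
    using D unfolding components_verts_def by auto
  \<comment> \<open>Adding arcs preserves connectivity, so a maximal connected subgraph is induced and inherits symmetry.\<close>
  have "arc_mono Digraph_Component.connected"
    unfolding arc_mono_def
    by (metis spanning_def subgraphE wf_digraph.connected_spanning_imp_connected)
  with C have "induced_subgraph C H"
    by (rule induced_subgraphI_arc_mono)
  then have "symmetric C" and wfC: "wf_digraph C"
    by (rule induced_graph_imp_symmetric[OF sym], rule wf_digraphI_induced)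
  moreover have "Digraph_Component.connected C"
    using C by (rule max_subgraph_prop)
  ultimately have sc: "strongly_connected C"
    by (metis wf_digraph.symmetric_connected_imp_strongly_connected)
  have imp: "Digraph_Component.connected K"
    if "strongly_connected K" "wf_digraph K" for K :: "('a, 'b) pre_digraph"
    using that wf_digraph.reachable_mk_symmetricI[of K]
    unfolding Digraph_Component.connected_def strongly_connected_def by simp
  have "max_subgraph strongly_connected C"
    using C sc imp unfolding max_subgraph_def by blast
  then have "C \<in> sccs"
    unfolding sccs_altdef2 by simp
  then show ?thesis
    unfolding DC sccs_verts_conv by (rule imageI)
qed

context connected_weighted_graph
begin

lemma induced_component:
  assumes S: "S \<subseteq> pverts G" and D: "D \<in> components_verts (with_proj G \<restriction> S)"
  shows "D \<noteq> {}" and "D \<subseteq> S"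
    and "\<And>i j. \<lbrakk>i \<in> D; j \<in> S; (i, j) \<in> parcs G\<rbrakk> \<Longrightarrow> j \<in> D"
    and "\<And>E. \<lbrakk>E \<in> components_verts (with_proj G \<restriction> S); E \<noteq> D\<rbrakk> \<Longrightarrow> D \<inter> E = {}"
proof -
  let ?H = "with_proj G \<restriction> S"
  have wf: "wf_digraph ?H"
    by (rule wellformed_induce_subgraph)
  have "induced_subgraph ?H (with_proj G)"
    using S by (intro induced_induce) simp
  then have sym: "symmetric ?H"
    by (rule induced_graph_imp_symmetric[OF sym_arcs])
  interpret H: wf_digraph ?H by (rule wf)
  note scc = component_in_sccs_verts[OF wf sym]
  have Ds: "D \<in> H.sccs_verts" by (rule scc[OF D])
  then show "D \<noteq> {}" 
    by (simp add: H.in_sccs_verts_conv_reachable)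
  show "D \<subseteq> S"
    using H.sccs_verts_subsets[OF Ds] by simp
  show "D \<inter> E = {}" if "E \<in> components_verts ?H" "E \<noteq> D" for E
    using H.sccs_verts_disjoint[OF Ds scc[OF that(1)]] that(2) by auto
  show "j \<in> D" if ij: "i \<in> D" "j \<in> S" "(i, j) \<in> parcs G" for i j
  proof (rule ccontr)
    assume "j \<notin> D"
    have adj: "(i, j) \<in> arcs_ends ?H"
      using ij \<open>D \<subseteq> S\<close> by (force simp: arcs_ends_conv)
    then have r: "i \<rightarrow>\<^sup>*\<^bsub>?H\<^esub> j" by (rule H.reachable_adjI)
    then have "j \<rightarrow>\<^sup>*\<^bsub>?H\<^esub> i" by (rule symmetric_reachable[OF sym])
    with r \<open>j \<notin> D\<close> ij(1) Ds show False
      by (auto simp: H.in_sccs_verts_conv_reachable)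
  qed
qed

text \<open>
  Connectivity enters the bound for weak domains only in this form.
\<close>

lemma arc_leaving:
  assumes "x \<in> D" "D \<subseteq> pverts G" "y \<in> pverts G" "y \<notin> D"
  obtains i j where "i \<in> D" "j \<notin> D" "(i, j) \<in> parcs G"
proof -
  have "strongly_connected (with_proj G)"
    by (rule symmetric_connected_imp_strongly_connected[OF sym_arcs connected])
  then have "x \<rightarrow>\<^sup>*\<^bsub>with_proj G\<^esub> y"
    using assms by (auto simp: strongly_connected_def)
  then have "\<exists>i j. i \<in> D \<and> j \<notin> D \<and> (i, j) \<in> parcs G"
    using assms(1,4) by (induct rule: converse_reachable_induct) auto
  then show thesis using that by blast
qed

end

section \<open>Underdetermined linear systems\<close>

text \<open>
  Gaussian elimination: a variable \<open>p\<close> occurring in equation \<open>k\<close> is solved for, which removes one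
  variable and one equation; \<open>c'\<close> is the coefficient matrix after the elimination.
\<close>

lemma underdetermined_homogeneous:
  fixes c :: "'j \<Rightarrow> 'i \<Rightarrow> 'a::field"
  assumes "finite J" "finite I" "card J < card I"
  shows "\<exists>\<alpha>. (\<exists>i\<in>I. \<alpha> i \<noteq> 0) \<and> (\<forall>j\<in>J. (\<Sum>i\<in>I. c j i * \<alpha> i) = 0)"
  using assms
proof (induction J arbitrary: I c rule: finite_induct)
  case empty
  then have "I \<noteq> {}" by auto
  then show ?case by (intro exI[of _ "\<lambda>_. 1"]) auto
next
  case (insert k J)
  show ?case
  proof (cases "\<forall>i\<in>I. c k i = 0")
    case True
    obtain \<alpha> where "\<exists>i\<in>I. \<alpha> i \<noteq> 0" "\<forall>j\<in>J. (\<Sum>i\<in>I. c j i * \<alpha> i) = 0"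
      using insert.IH[of I c] insert.prems insert.hyps by auto
    with True show ?thesis
      by (intro exI[of _ \<alpha>]) (auto intro: sum.neutral)
  next
    case False
    then obtain p where p: "p \<in> I" "c k p \<noteq> 0" by auto
    define c' where "c' j i = c j i - c j p * c k i / c k p" for j i
    have "card J < card (I - {p})"
      using insert.prems insert.hyps p by (simp add: card_Diff_singleton)
    then obtain \<beta> where \<beta>: "\<exists>i\<in>I - {p}. \<beta> i \<noteq> 0"
      "\<forall>j\<in>J. (\<Sum>i\<in>I - {p}. c' j i * \<beta> i) = 0"
      using insert.IH[of "I - {p}" c'] insert.prems by auto
    define s where "s = (\<Sum>i\<in>I - {p}. c k i * \<beta> i)"
    define \<alpha> where "\<alpha> = \<beta>(p := - s / c k p)"
    have split: "(\<Sum>i\<in>I. c j i * \<alpha> i) = (\<Sum>i\<in>I - {p}. c j i * \<beta> i) - c j p * s / c k p" for j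
    proof -
      have "(\<Sum>i\<in>I. c j i * \<alpha> i) = c j p * \<alpha> p + (\<Sum>i\<in>I - {p}. c j i * \<alpha> i)"
        using insert.prems(1) p(1) by (rule sum.remove)
      also have "(\<Sum>i\<in>I - {p}. c j i * \<alpha> i) = (\<Sum>i\<in>I - {p}. c j i * \<beta> i)"
        by (rule sum.cong) (auto simp: \<alpha>_def)
      finally show ?thesis by (simp add: \<alpha>_def)
    qed
    have "(\<Sum>i\<in>I. c k i * \<alpha> i) = 0"
      unfolding split using p(2) by (simp add: s_def)
    moreover have "(\<Sum>i\<in>I. c j i * \<alpha> i) = 0" if "j \<in> J" for j
    proof -
      have "(\<Sum>i\<in>I - {p}. c' j i * \<beta> i) = (\<Sum>i\<in>I - {p}. c j i * \<beta> i) - c j p * s / c k p"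
        unfolding s_def c'_def
        by (simp add: sum_subtractf sum_distrib_left sum_divide_distrib algebra_simps)
      then show ?thesis
        unfolding split using \<beta>(2) that by simp
    qed
    moreover have "\<exists>i\<in>I. \<alpha> i \<noteq> 0"
      using \<beta>(1) by (auto simp: \<alpha>_def)
    ultimately show ?thesis by blast
  qed
qed

section \<open>Diagonalization of real symmetric matrices\<close>

text \<open>
  Over the complex numbers an eigenpair \<open>(a, v)\<close> exists. The Hermitian form \<open>q\<close> at \<open>v\<close> equals
  \<open>a \<parallel>v\<parallel>\<^sup>2\<close> and is invariant under conjugation by symmetry of \<open>A\<close>; hence \<open>a\<close> is real, and it is a
  root of the real characteristic polynomial.
\<close>

lemma symmetric_real_eigenvalue_exists:
  fixes A :: "real mat"
  assumes A: "A \<in> carrier_mat n n" and sym: "A\<^sup>T = A" and n: "n > 0"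
  obtains e where "eigenvalue A e"
proof -
  define B where "B = map_mat complex_of_real A"
  have B: "B \<in> carrier_mat n n" using A by (simp add: B_def)
  obtain as where as: "char_poly B = (\<Prod>a\<leftarrow>as. [:- a, 1:])" "length as = n"
    using char_poly_factorized[OF B] by blast
  then obtain a where a: "a \<in> set as"
    using n by (cases as) auto
  then have "poly (char_poly B) a = 0"
    unfolding as(1) poly_prod_list by (auto simp: prod_list_zero_iff)
  then have "eigenvalue B a"
    by (simp add: eigenvalue_root_char_poly[OF B])
  then obtain v where v: "v \<in> carrier_vec n" "v \<noteq> 0\<^sub>v n" "B *\<^sub>v v = a \<cdot>\<^sub>v v"
    using B unfolding eigenvalue_def eigenvector_def by auto
  have symA: "A $$ (i, j) = A $$ (j, i)" if "i < n" "j < n" for i j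
    using A sym that by (metis carrier_matD index_transpose_mat(1))
  have row: "(\<Sum>j<n. complex_of_real (A $$ (i, j)) * v $ j) = a * v $ i" if "i < n" for i
  proof -
    have "(B *\<^sub>v v) $ i = (\<Sum>j<n. complex_of_real (A $$ (i, j)) * v $ j)"
      using that A B v(1) by (simp add: scalar_prod_def B_def lessThan_atLeast0)
    then show ?thesis using v that by simp
  qed
  define q where "q = (\<Sum>i<n. \<Sum>j<n. cnj (v $ i) * (complex_of_real (A $$ (i, j)) * v $ j))"
  define s where "s = (\<Sum>i<n. (cmod (v $ i))\<^sup>2)"
  have qs: "q = a * complex_of_real s"
  proof -
    have "q = (\<Sum>i<n. cnj (v $ i) * (a * v $ i))"
      unfolding q_def by (intro sum.cong refl) (simp add: sum_distrib_left[symmetric] row)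
    also have "\<dots> = a * complex_of_real s"
      unfolding s_def of_real_sum sum_distrib_left complex_norm_square
      by (intro sum.cong refl) (simp add: mult_ac)
    finally show ?thesis .
  qed
  have "cnj q = (\<Sum>i<n. \<Sum>j<n. cnj (v $ j) * (complex_of_real (A $$ (i, j)) * v $ i))"
    unfolding q_def by (simp add: mult_ac)
  also have "\<dots> = (\<Sum>j<n. \<Sum>i<n. cnj (v $ j) * (complex_of_real (A $$ (i, j)) * v $ i))"
    by (rule sum.swap)
  also have "\<dots> = q"
    unfolding q_def by (intro sum.cong refl) (simp add: symA)
  finally have "cnj q = q" .
  moreover have "s \<noteq> 0"
  proof -
    obtain i where "i < n" "v $ i \<noteq> 0"
      using v(1,2) by (metis carrier_vecD eq_vecI index_zero_vec)
    then show ?thesis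
      unfolding s_def by (subst sum_nonneg_eq_0_iff) auto
  qed
  ultimately have "cnj a = a"
    unfolding qs by simp
  then obtain e where e: "a = complex_of_real e"
    by (metis Reals_cases Reals_cnj_iff)
  have "eigenvalue A e"
  proof -
    have "poly (map_poly complex_of_real (char_poly A)) (complex_of_real e) = 0"
      using \<open>poly (char_poly B) a = 0\<close> of_real_hom.char_poly_hom[OF A]
      unfolding B_def e by metis
    then have "poly (char_poly A) e = 0"
      by simp
    then show ?thesis by (simp add: eigenvalue_root_char_poly[OF A])
  qed
  then show thesis by (rule that)
qed

text \<open>
  \<open>H\<close> is the Householder reflection that exchanges \<open>x\<close> and the first unit vector \<open>e\<close>, namely
  \<open>1 - 2 v v\<^sup>T / \<parallel>v\<parallel>\<^sup>2\<close> for \<open>v = x - e\<close>. As \<open>x\<close> is a unit vector, \<open>\<parallel>v\<parallel>\<^sup>2 = 2 (1 - x\<^sub>0)\<close>, which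
  explains the constant \<open>c\<close>; the reflection degenerates exactly when \<open>x = e\<close>.
\<close>

lemma orthogonal_mat_with_first_column:
  fixes x :: "real vec"
  assumes x: "x \<in> carrier_vec (Suc m)" and norm: "x \<bullet> x = 1"
  obtains H where "H \<in> carrier_mat (Suc m) (Suc m)" "H\<^sup>T * H = 1\<^sub>m (Suc m)" "col H 0 = x"
proof (cases "x $ 0 = 1")
  case True
  have "x $ i = 0" if "0 < i" "i < Suc m" for i
  proof -
    have "(\<Sum>i<Suc m. x $ i * x $ i) = 1"
      using norm x by (simp add: scalar_prod_def lessThan_atLeast0)
    then have "(\<Sum>i<m. x $ Suc i * x $ Suc i) = 0"
      unfolding sum.lessThan_Suc_shift using True by simp
    then have "\<forall>i\<in>{..<m}. x $ Suc i * x $ Suc i = 0"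
      by (subst (asm) sum_nonneg_eq_0_iff) auto
    with that show ?thesis by (cases i) auto
  qed
  with True x have "col (1\<^sub>m (Suc m)) 0 = x"
    by (intro eq_vecI) (auto simp: neq0_conv)
  then show thesis by (intro that[of "1\<^sub>m (Suc m)"]) auto
next
  case False
  define \<delta> where "\<delta> i j = (if i = j then 1 else 0 :: real)" for i j :: nat
  define v where "v i = x $ i - \<delta> i 0" for i
  define c where "c = 1 / (1 - x $ 0)"
  define H where "H = mat (Suc m) (Suc m) (\<lambda>(i, j). \<delta> i j - c * v i * v j)"
  have H: "H \<in> carrier_mat (Suc m) (Suc m)" by (simp add: H_def)
  have cx: "c * (1 - x $ 0) = 1" using False by (simp add: c_def)
  have s: "(\<Sum>k<Suc m. v k * v k) = 2 * (1 - x $ 0)"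
  proof -
    have "(\<Sum>i<Suc m. x $ i * x $ i) = 1"
      using norm x by (simp add: scalar_prod_def lessThan_atLeast0)
    then show ?thesis
      unfolding sum.lessThan_Suc_shift by (simp add: v_def \<delta>_def algebra_simps)
  qed
  have \<delta>_sum: "(\<Sum>k<Suc m. \<delta> k i * f k) = f i" if "i < Suc m" for i f
    using that by (simp add: \<delta>_def if_distrib[of "\<lambda>z. z * _"] cong: if_cong del: sum.lessThan_Suc)
  have "(H\<^sup>T * H) $$ (i, j) = \<delta> i j" if ij: "i < Suc m" "j < Suc m" for i j
  proof -
    have "(H\<^sup>T * H) $$ (i, j) = (\<Sum>k<Suc m. (\<delta> k i - c * v k * v i) * (\<delta> k j - c * v k * v j))"
      using ij H by (simp add: scalar_prod_def lessThan_atLeast0 H_def del: sum.lessThan_Suc)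
    also have "\<dots> = (\<Sum>k<Suc m. \<delta> k i * \<delta> k j - c * v j * (\<delta> k i * v k) - c * v i * (\<delta> k j * v k)
        + c * c * v i * v j * (v k * v k))"
      by (intro sum.cong refl) (simp add: algebra_simps)
    also have "\<dots> = \<delta> i j - c * v j * v i - c * v i * v j + c * c * v i * v j * (2 * (1 - x $ 0))"
      unfolding sum.distrib sum_subtractf sum_distrib_left[symmetric] s \<delta>_sum[OF ij(1)] \<delta>_sum[OF ij(2)] ..
    also have "\<dots> = \<delta> i j - 2 * c * v i * v j * (1 - c * (1 - x $ 0))"
      by (simp add: algebra_simps)
    finally show ?thesis by (simp add: cx)
  qed
  then have "H\<^sup>T * H = 1\<^sub>m (Suc m)"
    using H by (intro eq_matI) (auto simp: \<delta>_def)
  moreover have "col H 0 = x"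
  proof (rule eq_vecI)
    fix i assume "i < dim_vec x"
    then have i: "i < Suc m" using x by simp
    have "c * v 0 = - 1" using cx by (simp add: v_def \<delta>_def algebra_simps)
    then have "c * v i * v 0 = - v i"
      by (metis (no_types, opaque_lifting) mult.commute mult.left_commute mult_minus1)
    then show "col H 0 $ i = x $ i"
      using i by (simp add: H_def v_def)
  qed (use x in \<open>simp add: H_def\<close>)
  ultimately show thesis using H by (intro that)
qed

text \<open>
  The spectral theorem, by deflation. An orthogonal change of basis \<open>H\<close> that puts a unit eigenvector
  first makes the first column, and by symmetry the first row, of \<open>B = H\<^sup>T A H\<close> vanish off the
  diagonal; the remaining block \<open>C\<close> is symmetric and smaller.
\<close>

lemma symmetric_mat_diagonalization:
  fixes A :: "real mat"
  assumes "A \<in> carrier_mat n n" "A\<^sup>T = A"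
  shows "\<exists>P D. P \<in> carrier_mat n n \<and> D \<in> carrier_mat n n \<and> P\<^sup>T * P = 1\<^sub>m n
    \<and> diagonal_mat D \<and> A = P * D * P\<^sup>T"
  using assms
proof (induction n arbitrary: A)
  case 0
  then show ?case
    by (intro exI[of _ "1\<^sub>m 0"] exI[of _ A]) (auto simp: diagonal_mat_def)
next
  case (Suc m)
  note A = Suc.prems(1)
  obtain e where "eigenvalue A e"
    using symmetric_real_eigenvalue_exists[OF Suc.prems] by auto
  then obtain v where v: "v \<in> carrier_vec (Suc m)" "v \<noteq> 0\<^sub>v (Suc m)" "A *\<^sub>v v = e \<cdot>\<^sub>v v"
    using A unfolding eigenvalue_def eigenvector_def by auto
  have vv: "v \<bullet> v > 0"
    using conjugate_square_greater_0_vec[OF v(1)] v(2) by simp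
  define x where "x = (1 / sqrt (v \<bullet> v)) \<cdot>\<^sub>v v"
  have x: "x \<in> carrier_vec (Suc m)" using v by (simp add: x_def)
  have xx: "x \<bullet> x = 1"
    using vv v(1) by (simp add: x_def field_simps)
  have Ax: "A *\<^sub>v x = e \<cdot>\<^sub>v x"
    unfolding x_def mult_mat_vec[OF A v(1)] v(3) by (simp add: smult_smult_assoc mult.commute)
  obtain H where H: "H \<in> carrier_mat (Suc m) (Suc m)" and HH: "H\<^sup>T * H = 1\<^sub>m (Suc m)"
    and Hx: "col H 0 = x"
    by (rule orthogonal_mat_with_first_column[OF x xx])
  have HT: "H\<^sup>T \<in> carrier_mat (Suc m) (Suc m)" using H by simp
  have HH': "H * H\<^sup>T = 1\<^sub>m (Suc m)"
    by (rule mat_mult_left_right_inverse[OF HT H HH])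
  define B where "B = H\<^sup>T * A * H"
  have B: "B \<in> carrier_mat (Suc m) (Suc m)" using A H by (simp add: B_def)
  have "B\<^sup>T = H\<^sup>T * (A\<^sup>T * H)"
    using A H unfolding B_def by (simp add: transpose_mult[of _ "Suc m" "Suc m" _ "Suc m"])
  then have symB: "B\<^sup>T = B"
    unfolding Suc.prems(2) using A H by (simp add: B_def)
  have col0: "B $$ (i, 0) = (if i = 0 then e else 0)" if i: "i < Suc m" for i
  proof -
    have "col B 0 = H\<^sup>T *\<^sub>v (A *\<^sub>v col H 0)"
      unfolding B_def assoc_mult_mat[OF HT A H] col_mult2[OF HT mult_carrier_mat[OF A H] zero_less_Suc]
        col_mult2[OF A H zero_less_Suc] ..
    also have "\<dots> = e \<cdot>\<^sub>v (H\<^sup>T *\<^sub>v col H 0)"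
      unfolding Hx Ax by (rule mult_mat_vec[OF HT x])
    also have "H\<^sup>T *\<^sub>v col H 0 = col (H\<^sup>T * H) 0"
      by (rule col_mult2[OF HT H zero_less_Suc, symmetric])
    finally have "col B 0 $ i = (e \<cdot>\<^sub>v col (1\<^sub>m (Suc m)) 0) $ i"
      unfolding HH by simp
    then show ?thesis using i B by simp
  qed
  define C where "C = mat m m (\<lambda>(i, j). B $$ (Suc i, Suc j))"
  define E where "E = mat 1 1 (\<lambda>_. e)"
  have Bsym: "B $$ (i, j) = B $$ (j, i)" if "i < Suc m" "j < Suc m" for i j
    using B symB that by (metis carrier_matD index_transpose_mat(1))
  have C: "C \<in> carrier_mat m m" by (simp add: C_def)
  have "C\<^sup>T = C"
    by (rule eq_matI) (auto simp: C_def intro: Bsym)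
  then obtain Q F where Q: "Q \<in> carrier_mat m m" and F: "F \<in> carrier_mat m m"
    and QQ: "Q\<^sup>T * Q = 1\<^sub>m m" and diagF: "diagonal_mat F" and CQ: "C = Q * F * Q\<^sup>T"
    using Suc.IH[OF C] by blast
  have E: "E \<in> carrier_mat 1 1" by (simp add: E_def)
  let ?z = "0\<^sub>m 1 m :: real mat" and ?z' = "0\<^sub>m m 1 :: real mat"
  have B_block: "B = four_block_mat E ?z ?z' C"
  proof (rule eq_matI)
    fix i j
    assume "i < dim_row (four_block_mat E ?z ?z' C)" "j < dim_col (four_block_mat E ?z ?z' C)"
    then have ij: "i < Suc m" "j < Suc m" using E C by auto
    show "B $$ (i, j) = four_block_mat E ?z ?z' C $$ (i, j)"
    proof (cases i)
      case i: 0
      show ?thesis using col0[OF ij(2)] Bsym[OF ij] ij C E i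
        by (cases j) (auto simp: E_def)
    next
      case i: (Suc i')
      show ?thesis using col0[OF ij(1)] ij C E i
        by (cases j) (auto simp: C_def)
    qed
  qed (use B E C in auto)
  define R where "R = four_block_mat (1\<^sub>m 1) ?z ?z' Q"
  define D where "D = four_block_mat E ?z ?z' F"
  have R: "R \<in> carrier_mat (Suc m) (Suc m)" and D: "D \<in> carrier_mat (Suc m) (Suc m)"
    using Q F E by (auto simp: R_def D_def)
  have QT: "Q\<^sup>T \<in> carrier_mat m m" using Q by simp
  have RT: "R\<^sup>T = four_block_mat (1\<^sub>m 1) ?z ?z' Q\<^sup>T"
    unfolding R_def using Q by (subst transpose_four_block_mat[of _ 1 1 _ m _ m]) auto
  have "R\<^sup>T * R = four_block_mat (1\<^sub>m 1) ?z ?z' (1\<^sub>m m)"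
    unfolding RT unfolding R_def using Q QT
    by (subst mult_four_block_mat[of _ 1 1 _ m _ m _ _ 1 _ m]) (auto simp: QQ)
  then have RR: "R\<^sup>T * R = 1\<^sub>m (Suc m)"
    by (simp add: four_block_one_mat)
  have "R * D = four_block_mat E ?z ?z' (Q * F)"
    unfolding R_def D_def using Q F E
    by (subst mult_four_block_mat[of _ 1 1 _ m _ m _ _ 1 _ m]) auto
  then have RDR: "R * D * R\<^sup>T = B"
    unfolding RT B_block CQ using Q QT F E
    by (simp add: mult_four_block_mat[of _ 1 1 _ m _ m _ _ 1 _ m])
  have "diagonal_mat D"
    using diagF E F unfolding diagonal_mat_def D_def by auto
  moreover have HR: "(H * R)\<^sup>T = R\<^sup>T * H\<^sup>T"
    by (rule transpose_mult[OF H R])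
  have RTc: "R\<^sup>T \<in> carrier_mat (Suc m) (Suc m)" using R by simp
  have "(H * R)\<^sup>T * (H * R) = R\<^sup>T * (H\<^sup>T * H) * R"
    unfolding HR using H HT R RTc by (simp add: assoc_mult_mat[of _ "Suc m" "Suc m" _ "Suc m" _ "Suc m"])
  then have "(H * R)\<^sup>T * (H * R) = 1\<^sub>m (Suc m)"
    unfolding HH using RTc RR by simp
  moreover have "H * R * D * (H * R)\<^sup>T = H * (R * D * R\<^sup>T) * H\<^sup>T"
    unfolding HR using H HT R RTc D by (simp add: assoc_mult_mat[of _ "Suc m" "Suc m" _ "Suc m" _ "Suc m"])
  then have "H * R * D * (H * R)\<^sup>T = (H * H\<^sup>T) * A * (H * H\<^sup>T)"
    unfolding RDR B_def using H HT A by (simp add: assoc_mult_mat[of _ "Suc m" "Suc m" _ "Suc m" _ "Suc m"])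
  then have "A = H * R * D * (H * R)\<^sup>T"
    unfolding HH' using A by simp
  ultimately show ?case
    using H R D by (intro exI[of _ "H * R"] exI[of _ D]) auto
qed

text \<open>
  Links the algebraic multiplicities to the diagonalization: the columns of \<open>P\<close> whose diagonal entry
  satisfies \<open>Q\<close> are as many as the counted eigenvalues.
\<close>

lemma count_eigenvalues_diagonalization:
  assumes P: "P \<in> carrier_mat n n" and D: "D \<in> carrier_mat n n" and PP: "P\<^sup>T * P = 1\<^sub>m n"
    and diag: "diagonal_mat D" and A: "A = P * D * P\<^sup>T"
  shows "count_eigenvalues A Q = card {i. i < n \<and> Q (D $$ (i, i))}"
proof -
  let ?es = "diag_mat D"
  have PT: "P\<^sup>T \<in> carrier_mat n n" using P by simp
  have PP': "P * P\<^sup>T = 1\<^sub>m n" by (rule mat_mult_left_right_inverse[OF PT P PP])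
  have Ac: "A \<in> carrier_mat n n" using P D by (simp add: A)
  have "similar_mat A D"
    unfolding similar_mat_def
    by (intro exI[of _ P] exI[of _ "P\<^sup>T"] similar_mat_witI[OF PP' PP A Ac D P PT])
  then have "char_poly A = char_poly D"
    by (rule char_poly_similar)
  also have "\<dots> = (\<Prod>a\<leftarrow>?es. [:- a, 1:])"
    using D diag by (intro char_poly_upper_triangular) (auto simp: diagonal_mat_def upper_triangular_def)
  finally have cp: "char_poly A = (\<Prod>a\<leftarrow>?es. [:- a, 1:])" .
  have ev: "eigenvalue A \<mu> \<longleftrightarrow> \<mu> \<in> set ?es" for \<mu>
    unfolding eigenvalue_root_char_poly[OF Ac] cp poly_prod_list by (auto simp: prod_list_zero_iff)
  have ord: "order \<mu> (\<Prod>a\<leftarrow>es. [:- a, 1:]) = count_list es \<mu>" for \<mu> and es :: "real list"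
  proof (induction es)
    case (Cons a es)
    have "(\<Prod>a\<leftarrow>es. [:- a, 1:]) \<noteq> 0"
      by (auto simp: prod_list_zero_iff)
    then have "[:- a, 1:] * (\<Prod>a\<leftarrow>es. [:- a, 1:]) \<noteq> 0"
      by (metis mult_eq_0_iff one_neq_zero pCons_eq_0_iff)
    then show ?case
      using Cons by (simp add: order_mult order_linear' del: mult_pCons_left)
  qed (simp add: order_1_eq_0)
  have "count_eigenvalues A Q = (\<Sum>\<mu> | \<mu> \<in> set ?es \<and> Q \<mu>. count_list ?es \<mu>)"
    unfolding count_eigenvalues_def ev cp ord ..
  also have "\<dots> = (\<Sum>\<mu>\<in>set (filter Q ?es). count_list (filter Q ?es) \<mu>)"
  proof (intro sum.cong)
    have "count_list (filter Q xs) \<mu> = count_list xs \<mu>" if "Q \<mu>" for \<mu> xs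
      using that by (induction xs) auto
    then show "count_list ?es \<mu> = count_list (filter Q ?es) \<mu>" if "\<mu> \<in> set (filter Q ?es)" for \<mu>
      using that by simp
  qed auto
  also have "\<dots> = length (filter Q ?es)"
    by (rule sum_count_set) auto
  also have "\<dots> = card {i. i < n \<and> Q (D $$ (i, i))}"
    unfolding length_filter_conv_card using D
    by (intro arg_cong[where f = card]) (auto simp: diag_mat_def)
  finally show ?thesis .
qed

section \<open>Rayleigh quotients\<close>

text \<open>
  In the coordinates \<open>y = P\<^sup>T v\<close> the difference \<open>t \<parallel>v\<parallel>\<^sup>2 - v \<bullet> A v\<close> is the sum of
  \<open>(t - D\<^sub>i\<^sub>i) y\<^sub>i\<^sup>2\<close>. All terms are nonnegative when the coordinates with \<open>D\<^sub>i\<^sub>i > t\<close> vanish, and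
  equality forces each term to be zero, so that only coordinates with \<open>D\<^sub>i\<^sub>i = t\<close> survive. The
  predicate \<open>Q\<close> stands for \<open>\<mu> > t\<close> or \<open>\<mu> \<ge> t\<close>; in the second case equality leaves nothing at all.
\<close>

lemma rayleigh_bound_off_large_eigenvectors:
  fixes A :: "real mat"
  assumes P: "P \<in> carrier_mat n n" and D: "D \<in> carrier_mat n n" and PP: "P\<^sup>T * P = 1\<^sub>m n"
    and diag: "diagonal_mat D" and A: "A = P * D * P\<^sup>T"
    and v: "v \<in> carrier_vec n"
    and above: "\<And>\<mu>. \<mu> > t \<Longrightarrow> Q \<mu>"
    and orth: "\<And>i. \<lbrakk>i < n; Q (D $$ (i, i))\<rbrakk> \<Longrightarrow> (P\<^sup>T *\<^sub>v v) $ i = 0"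
  shows "v \<bullet> (A *\<^sub>v v) \<le> t * (v \<bullet> v)"
    and "v \<bullet> (A *\<^sub>v v) = t * (v \<bullet> v) \<Longrightarrow> A *\<^sub>v v = t \<cdot>\<^sub>v v"
    and "\<lbrakk>v \<bullet> (A *\<^sub>v v) = t * (v \<bullet> v); Q t\<rbrakk> \<Longrightarrow> v = 0\<^sub>v n"
proof -
  have PT: "P\<^sup>T \<in> carrier_mat n n" using P by simp
  have PP': "P * P\<^sup>T = 1\<^sub>m n" by (rule mat_mult_left_right_inverse[OF PT P PP])
  define y where "y = P\<^sup>T *\<^sub>v v"
  have y: "y \<in> carrier_vec n" using P v by (simp add: y_def)
  have v_y: "P *\<^sub>v y = v"
    using assoc_mult_mat_vec[OF P PT v] v by (simp add: PP' y_def)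
  have Dy: "D *\<^sub>v y \<in> carrier_vec n" using D y by simp
  have Av: "A *\<^sub>v v = P *\<^sub>v (D *\<^sub>v y)"
    unfolding A y_def using P D PT v by (simp add: assoc_mult_mat_vec[of _ n n _ n])
  have Dyi: "(D *\<^sub>v y) $ i = D $$ (i, i) * y $ i" if i: "i < n" for i
  proof -
    have "(D *\<^sub>v y) $ i = (\<Sum>j<n. D $$ (i, j) * y $ j)"
      using i D y by (simp add: scalar_prod_def lessThan_atLeast0)
    also have "\<dots> = (\<Sum>j\<in>{i}. D $$ (i, j) * y $ j)"
      using i D diag by (intro sum.mono_neutral_right) (auto simp: diagonal_mat_def)
    finally show ?thesis by simp
  qed
  have "v \<bullet> v = v \<bullet> (P *\<^sub>v y)" by (simp add: v_y)
  also have "\<dots> = y \<bullet> y"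
    using transpose_vec_mult_scalar[OF P y v] by (simp only: y_def)
  finally have vv: "v \<bullet> v = (\<Sum>i<n. y $ i * y $ i)"
    using y by (simp add: scalar_prod_def lessThan_atLeast0)
  have "v \<bullet> (A *\<^sub>v v) = y \<bullet> (D *\<^sub>v y)"
    unfolding Av using transpose_vec_mult_scalar[OF P Dy v] by (simp only: y_def)
  also have "\<dots> = (\<Sum>i<n. y $ i * (D *\<^sub>v y) $ i)"
    using D by (simp add: scalar_prod_def lessThan_atLeast0 del: index_mult_mat_vec)
  finally have vAv: "v \<bullet> (A *\<^sub>v v) = (\<Sum>i<n. D $$ (i, i) * y $ i * y $ i)"
    by (simp add: Dyi mult_ac del: index_mult_mat_vec)
  have gap: "t * (v \<bullet> v) - v \<bullet> (A *\<^sub>v v) = (\<Sum>i<n. (t - D $$ (i, i)) * (y $ i * y $ i))"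
    unfolding vv vAv by (simp add: sum_distrib_left sum_subtractf[symmetric] algebra_simps)
  have terms: "(t - D $$ (i, i)) * (y $ i * y $ i) \<ge> 0" if "i < n" for i
  proof (cases "D $$ (i, i) > t")
    case True
    then show ?thesis using orth[OF that above] by (simp add: y_def)
  qed simp
  show "v \<bullet> (A *\<^sub>v v) \<le> t * (v \<bullet> v)"
    using gap terms sum_nonneg[of "{..<n}" "\<lambda>i. (t - D $$ (i, i)) * (y $ i * y $ i)"] by simp
  have eq: "y $ i = 0 \<or> D $$ (i, i) = t" if "v \<bullet> (A *\<^sub>v v) = t * (v \<bullet> v)" "i < n" for i
  proof -
    have "(\<Sum>i<n. (t - D $$ (i, i)) * (y $ i * y $ i)) = 0"
      using gap that(1) by simp
    then have "\<forall>i\<in>{..<n}. (t - D $$ (i, i)) * (y $ i * y $ i) = 0"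
      using terms by (subst (asm) sum_nonneg_eq_0_iff) auto
    then show ?thesis using that(2) by auto
  qed
  show "A *\<^sub>v v = t \<cdot>\<^sub>v v" if e: "v \<bullet> (A *\<^sub>v v) = t * (v \<bullet> v)"
  proof -
    have "D *\<^sub>v y = t \<cdot>\<^sub>v y"
      using eq[OF e] D y by (intro eq_vecI) (auto simp: Dyi simp del: index_mult_mat_vec)
    then show ?thesis
      unfolding Av using mult_mat_vec[OF P y] by (simp add: v_y)
  qed
  show "v = 0\<^sub>v n" if e: "v \<bullet> (A *\<^sub>v v) = t * (v \<bullet> v)" and Qt: "Q t"
  proof -
    have "y $ i = 0" if i: "i < n" for i
      using eq[OF e i] orth[OF i] Qt by (auto simp: y_def)
    then have "y = 0\<^sub>v n" using y by (intro eq_vecI) auto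
    then show ?thesis using v_y P by auto
  qed
qed

text \<open>
  The dimension count of the Courant-Fischer principle. In a family of more than \<open>\<ell> + 1\<close> vectors
  \<open>w p\<close>, where \<open>\<ell>\<close> eigenvalues satisfy \<open>Q\<close>, some nontrivial combination is orthogonal to the \<open>\<ell>\<close>
  eigenvectors and to one further vector \<open>d\<close>. Independence of the family is left to the application,
  hence the conclusion is that the coefficients, rather than \<open>v\<close>, are not all zero.
\<close>

lemma rayleigh_bound_on_large_span:
  fixes A :: "real mat" and w :: "'i \<Rightarrow> nat \<Rightarrow> real" and d :: "nat \<Rightarrow> real"
  assumes A: "A \<in> carrier_mat n n" and sym: "A\<^sup>T = A" and fin: "finite I"
    and above: "\<And>\<mu>. \<mu> > t \<Longrightarrow> Q \<mu>"
    and few: "count_eigenvalues A Q + 1 < card I"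
  obtains \<alpha> v where "\<exists>p\<in>I. \<alpha> p \<noteq> 0" and "v = vec n (\<lambda>x. \<Sum>p\<in>I. \<alpha> p * w p x)"
    and "(\<Sum>x<n. d x * v $ x) = 0"
    and "v \<bullet> (A *\<^sub>v v) \<le> t * (v \<bullet> v)"
    and "v \<bullet> (A *\<^sub>v v) = t * (v \<bullet> v) \<longrightarrow> A *\<^sub>v v = t \<cdot>\<^sub>v v \<and> (Q t \<longrightarrow> v = 0\<^sub>v n)"
proof -
  obtain P D where PD: "P \<in> carrier_mat n n" "D \<in> carrier_mat n n" "P\<^sup>T * P = 1\<^sub>m n"
    "diagonal_mat D" "A = P * D * P\<^sup>T"
    using symmetric_mat_diagonalization[OF A sym] by blast
  define K where "K = {i. i < n \<and> Q (D $$ (i, i))}"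
  have K: "finite K" by (simp add: K_def)
  \<comment> \<open>The linear conditions on \<open>v\<close>: orthogonality to \<open>d\<close> (\<open>None\<close>) and to column \<open>i\<close> of \<open>P\<close> (\<open>Some i\<close>).\<close>
  define functional where
    "functional j = (case j of None \<Rightarrow> d | Some i \<Rightarrow> (\<lambda>x. P $$ (x, i)))" for j
  define c where "c j p = (\<Sum>x<n. functional j x * w p x)" for j p
  have "card (insert None (Some ` K)) = card K + 1"
    using K by (subst card_insert_disjoint) (auto simp: card_image)
  also have "\<dots> < card I"
    using few unfolding count_eigenvalues_diagonalization[OF PD] K_def .
  finally obtain \<alpha> where \<alpha>: "\<exists>p\<in>I. \<alpha> p \<noteq> 0"
    "\<forall>j\<in>insert None (Some ` K). (\<Sum>p\<in>I. c j p * \<alpha> p) = 0"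
    using underdetermined_homogeneous[of "insert None (Some ` K)" I c] K fin by auto
  define v where "v = vec n (\<lambda>x. \<Sum>p\<in>I. \<alpha> p * w p x)"
  have v: "v \<in> carrier_vec n" by (simp add: v_def)
  have zero: "(\<Sum>x<n. functional j x * v $ x) = 0" if "j \<in> insert None (Some ` K)" for j
  proof -
    have "(\<Sum>x<n. functional j x * v $ x) = (\<Sum>x<n. \<Sum>p\<in>I. functional j x * w p x * \<alpha> p)"
      unfolding v_def by (intro sum.cong refl) (simp add: sum_distrib_left mult_ac)
    also have "\<dots> = (\<Sum>p\<in>I. c j p * \<alpha> p)"
      unfolding c_def sum_distrib_right by (rule sum.swap)
    finally show ?thesis using bspec[OF \<alpha>(2) that] by simp
  qed
  have "(P\<^sup>T *\<^sub>v v) $ i = 0" if "i < n" "Q (D $$ (i, i))" for i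
  proof -
    have "(P\<^sup>T *\<^sub>v v) $ i = (\<Sum>x<n. functional (Some i) x * v $ x)"
      using that(1) PD(1) v by (simp add: scalar_prod_def functional_def lessThan_atLeast0)
    then show ?thesis using zero[of "Some i"] that by (simp add: K_def)
  qed
  note bound = rayleigh_bound_off_large_eigenvectors[OF PD v above this]
  show thesis
  proof (rule that[OF \<alpha>(1) v_def])
    show "(\<Sum>x<n. d x * v $ x) = 0"
      using zero[of None] by (simp add: functional_def)
  qed (use bound in auto)
qed

section \<open>Nodal domains of the modularity matrix\<close>

context connected_weighted_graph
begin

abbreviation adj :: "nat \<Rightarrow> nat \<Rightarrow> real" where
  "adj x y \<equiv> adjacency_mat G n \<omega> $$ (x, y)"

abbreviation deg :: "nat \<Rightarrow> real" where
  "deg x \<equiv> degree_vec G n \<omega> $ x"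

abbreviation M :: "real mat" where
  "M \<equiv> modularity_mat G n \<omega>"

lemma adj_eq: "\<lbrakk>x < n; y < n\<rbrakk> \<Longrightarrow> adj x y = (if (x, y) \<in> parcs G then \<omega> (x, y) else 0)"
  by (simp add: adjacency_mat_def)

lemma adj_nonneg: "\<lbrakk>x < n; y < n\<rbrakk> \<Longrightarrow> adj x y \<ge> 0"
  using weight_pos by (auto simp: adj_eq intro: less_imp_le)

lemma adj_sym: "\<lbrakk>x < n; y < n\<rbrakk> \<Longrightarrow> adj x y = adj y x"
  using weight_sym arcs_symmetric by (auto simp: adj_eq)

lemma deg_nonneg: "x < n \<Longrightarrow> deg x \<ge> 0"
  by (auto simp: degree_vec_def intro!: sum_nonneg adj_nonneg)

lemma volume_nonneg: "volume G n \<omega> \<ge> 0"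
  unfolding volume_def by (auto intro!: sum_nonneg deg_nonneg)

lemma modularity_carrier: "M \<in> carrier_mat n n"
  by (intro carrier_matI) (simp_all add: modularity_mat_def adjacency_mat_def)

lemma modularity_entry:
  assumes "x < n" "y < n"
  shows "M $$ (x, y) = adj x y - 1 / volume G n \<omega> * (deg x * deg y)"
  using assms by (simp add: modularity_mat_def adjacency_mat_def)

lemma modularity_sym: "M\<^sup>T = M"
  using modularity_carrier
  by (intro eq_matI) (auto simp: modularity_entry adj_sym mult.commute)

lemma modularity_mult_vec:
  assumes v: "v \<in> carrier_vec n" and x: "x < n"
  shows "(M *\<^sub>v v) $ x
    = (\<Sum>y<n. adj x y * v $ y) - deg x * ((\<Sum>y<n. deg y * v $ y) / volume G n \<omega>)"
proof -
  have "(M *\<^sub>v v) $ x = (\<Sum>y<n. M $$ (x, y) * v $ y)"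
    using modularity_carrier v x by (simp add: scalar_prod_def lessThan_atLeast0)
  also have "\<dots> = (\<Sum>y<n. adj x y * v $ y - deg x / volume G n \<omega> * (deg y * v $ y))"
    using x by (intro sum.cong refl) (simp add: modularity_entry algebra_simps)
  finally show ?thesis
    by (simp add: sum_subtractf sum_distrib_left sum_divide_distrib)
qed

text \<open>
  Strong domains arise from \<open>S = {u > 0}\<close> with \<open>Q \<mu> \<longleftrightarrow> \<mu> \<ge> ev\<close>, weak domains from \<open>S = {u \<ge> 0}\<close>
  with \<open>Q \<mu> \<longleftrightarrow> \<mu> > ev\<close>. The test vector satisfies \<open>v \<bullet> M v = ev \<parallel>v\<parallel>\<^sup>2\<close>. If \<open>Q ev\<close>
  holds, it is then zero, although its coefficients are not; otherwise it is an eigenvector, which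
  an edge leaving a domain with nonzero coefficient refutes.
\<close>

lemma nodal_domain_bound:
  assumes eig: "eigenvector M u ev" and du: "degree_vec G n \<omega> \<bullet> u \<ge> 0"
    and S: "S \<subseteq> pverts G" and u_in: "\<And>x. x \<in> S \<Longrightarrow> u $ x \<ge> 0"
    and u_out: "\<And>x. \<lbrakk>x < n; x \<notin> S\<rbrakk> \<Longrightarrow> u $ x \<le> 0"
    and above: "\<And>\<mu>. \<mu> > ev \<Longrightarrow> Q \<mu>"
    and alt: "Q ev \<or> S \<noteq> pverts G \<and> (\<forall>x<n. x \<notin> S \<longrightarrow> u $ x < 0)"
  defines "\<D> \<equiv> {D \<in> components_verts (with_proj G \<restriction> S). \<exists>i\<in>D. u $ i \<noteq> 0}"
  shows "card \<D> \<le> count_eigenvalues M Q + 1"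
proof (rule ccontr)
  assume "\<not> card \<D> \<le> count_eigenvalues M Q + 1"
  then have few: "count_eigenvalues M Q + 1 < card \<D>" by simp
  note comp = induced_component[OF S]
  have V: "pverts G = {..<n}" by (simp add: verts_eq lessThan_atLeast0)
  have sub: "D \<subseteq> {..<n}" if "D \<in> \<D>" for D
    using comp(2)[of D] that S V by (auto simp: \<D>_def)
  have fin: "finite \<D>"
    by (rule finite_subset[of _ "Pow {..<n}"]) (use sub in auto)
  have u: "u \<in> carrier_vec n" and Mu: "M *\<^sub>v u = ev \<cdot>\<^sub>v u"
    using eig modularity_carrier by (auto simp: eigenvector_def)
  define c where "c = (\<Sum>y<n. deg y * u $ y) / volume G n \<omega>"
  have "degree_vec G n \<omega> \<bullet> u = (\<Sum>y<n. deg y * u $ y)"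
    using u by (simp add: scalar_prod_def lessThan_atLeast0)
  then have c: "c \<ge> 0"
    using du volume_nonneg by (simp add: c_def)
  have Au: "(\<Sum>y<n. adj x y * u $ y) = ev * u $ x + c * deg x" if "x < n" for x
    using modularity_mult_vec[OF u that] u that unfolding Mu c_def by simp
  define w where "w D x = (if x \<in> D then u $ x else 0)" for D x
  obtain \<alpha> v where \<alpha>: "\<exists>D\<in>\<D>. \<alpha> D \<noteq> 0" and v_def: "v = vec n (\<lambda>x. \<Sum>D\<in>\<D>. \<alpha> D * w D x)"
    and dv: "(\<Sum>x<n. deg x * v $ x) = 0"
    and le: "v \<bullet> (M *\<^sub>v v) \<le> ev * (v \<bullet> v)"
    and eq: "v \<bullet> (M *\<^sub>v v) = ev * (v \<bullet> v) \<longrightarrow> M *\<^sub>v v = ev \<cdot>\<^sub>v v \<and> (Q ev \<longrightarrow> v = 0\<^sub>v n)"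
    by (rule rayleigh_bound_on_large_span[where w = w and d = deg and t = ev and Q = Q,
        OF modularity_carrier modularity_sym fin above few])
  have v: "v \<in> carrier_vec n" by (simp add: v_def)
  have v_in: "v $ x = \<alpha> D * u $ x" if D: "D \<in> \<D>" "x \<in> D" for D x
  proof -
    have "x < n" using sub that by auto
    then have "v $ x = (\<Sum>E\<in>\<D>. \<alpha> E * w E x)" by (simp add: v_def)
    also have "\<dots> = (\<Sum>E\<in>{D}. \<alpha> E * w E x)"
      using D fin comp(4)[of D] by (intro sum.mono_neutral_right) (auto simp: w_def \<D>_def)
    finally show ?thesis using D by (simp add: w_def)
  qed
  have v_out: "v $ x = 0" if "x < n" "x \<notin> \<Union>\<D>" for x
    using that by (auto simp: v_def w_def intro!: sum.neutral)
  \<comment> \<open>The surplus of \<open>A w\<^sub>D\<close> over \<open>ev u\<close> on \<open>D\<close>: \<open>c d\<close>, minus the nonpositive contributions to \<open>A u\<close> from outside \<open>D\<close>.\<close>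
  define r where "r D x = c * deg x + (\<Sum>y\<in>{..<n} - D. adj x y * - u $ y)" for D x
  have leaving: "adj x y = 0 \<or> y \<notin> S" if "D \<in> \<D>" "x \<in> D" "y < n" "y \<notin> D" for D x y
  proof -
    have "x < n" using sub that by auto
    moreover have "D \<in> components_verts (with_proj G \<restriction> S)" using that(1) by (simp add: \<D>_def)
    ultimately show ?thesis using comp(3) that by (auto simp: adj_eq)
  qed
  have Mv: "(M *\<^sub>v v) $ x = ev * v $ x + \<alpha> D * r D x" if D: "D \<in> \<D>" "x \<in> D" for D x
  proof -
    have x: "x < n" using sub D by auto
    \<comment> \<open>A vertex outside \<open>D\<close> lies in another domain, which is not adjacent to \<open>D\<close>, or in none, where \<open>v\<close> vanishes.\<close>
    have "adj x y * v $ y = 0" if "y < n" "y \<notin> D" for y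
    proof (cases "y \<in> \<Union>\<D>")
      case True
      then have "y \<in> S" using comp(2) by (auto simp: \<D>_def)
      then show ?thesis using leaving[OF D that] by simp
    next
      case False
      then show ?thesis using v_out that(1) by simp
    qed
    then have "(\<Sum>y<n. adj x y * v $ y) = (\<Sum>y\<in>D. adj x y * v $ y)"
      using sub[OF D(1)] by (intro sum.mono_neutral_right) auto
    also have "\<dots> = \<alpha> D * (\<Sum>y\<in>D. adj x y * u $ y)"
      unfolding sum_distrib_left by (intro sum.cong refl) (simp add: v_in[OF D(1)])
    also have "(\<Sum>y\<in>D. adj x y * u $ y) = (\<Sum>y<n. adj x y * u $ y) - (\<Sum>y\<in>{..<n} - D. adj x y * u $ y)"
      using sub[OF D(1)] by (simp add: sum_diff)
    also have "\<dots> = ev * u $ x + r D x"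
      unfolding Au[OF x] r_def by (simp add: sum_negf)
    finally show ?thesis
      unfolding modularity_mult_vec[OF v x] dv by (simp add: v_in[OF D] algebra_simps)
  qed
  have outflow: "adj x y * - u $ y \<ge> 0" if "D \<in> \<D>" "x \<in> D" "y < n" "y \<notin> D" for D x y
  proof (cases "adj x y = 0")
    case False
    then have "u $ y \<le> 0" using leaving[OF that] u_out that(3) by blast
    moreover have "adj x y \<ge> 0" using adj_nonneg sub that by blast
    ultimately show ?thesis by (intro mult_nonneg_nonneg) auto
  qed simp
  have r_nonneg: "r D x \<ge> 0" if "D \<in> \<D>" "x \<in> D" for D x
    unfolding r_def using that sub c
    by (intro add_nonneg_nonneg mult_nonneg_nonneg sum_nonneg deg_nonneg outflow) auto
  have "ev * (v \<bullet> v) = (\<Sum>x<n. ev * (v $ x * v $ x))"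
    using v by (simp add: scalar_prod_def lessThan_atLeast0 sum_distrib_left)
  also have "\<dots> \<le> (\<Sum>x<n. v $ x * (M *\<^sub>v v) $ x)"
  proof (rule sum_mono)
    fix x assume x: "x \<in> {..<n}"
    show "ev * (v $ x * v $ x) \<le> v $ x * (M *\<^sub>v v) $ x"
    proof (cases "x \<in> \<Union>\<D>")
      case True
      then obtain D where D: "D \<in> \<D>" "x \<in> D" by auto
      then have ux: "u $ x \<ge> 0" using comp(2) u_in by (auto simp: \<D>_def)
      have "0 \<le> \<alpha> D * \<alpha> D * (u $ x * r D x)"
        by (rule mult_nonneg_nonneg[OF zero_le_square mult_nonneg_nonneg[OF ux r_nonneg[OF D]]])
      then show ?thesis
        unfolding Mv[OF D] v_in[OF D] by (simp add: algebra_simps)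
    next
      case False
      then show ?thesis using v_out x by simp
    qed
  qed
  also have "\<dots> = v \<bullet> (M *\<^sub>v v)"
    using v modularity_carrier by (simp add: scalar_prod_def lessThan_atLeast0)
  finally have tight: "v \<bullet> (M *\<^sub>v v) = ev * (v \<bullet> v)"
    using le by simp
  obtain D where D: "D \<in> \<D>" "\<alpha> D \<noteq> 0" using \<alpha> by auto
  from alt show False
  proof
    assume "Q ev"
    then have "v = 0\<^sub>v n" using eq tight by blast
    moreover obtain x where "x \<in> D" "u $ x \<noteq> 0" using D by (auto simp: \<D>_def)
    ultimately show False using v_in[of D x] D sub[of D] by auto
  next
    assume neg: "S \<noteq> pverts G \<and> (\<forall>x<n. x \<notin> S \<longrightarrow> u $ x < 0)"
    have comp_D: "D \<in> components_verts (with_proj G \<restriction> S)" using D by (simp add: \<D>_def)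
    obtain z where z: "z \<in> pverts G" "z \<notin> D" using neg S comp(2)[OF comp_D] by auto
    obtain a where a: "a \<in> D" using comp(1)[OF comp_D] by auto
    have "D \<subseteq> pverts G" using sub D V by simp
    then obtain x y where xy: "x \<in> D" "y \<notin> D" "(x, y) \<in> parcs G"
      using arc_leaving[OF a _ z] by metis
    have x: "x < n" and y: "y < n"
      using xy in_arcsD1 in_arcsD2 V by auto
    have "adj x y > 0" using weight_pos xy(3) x y by (simp add: adj_eq)
    moreover have "u $ y < 0"
      using leaving[OF D(1) xy(1) y xy(2)] calculation neg y by auto
    ultimately have "0 < adj x y * - u $ y" by (simp add: mult_pos_neg)
    also have "\<dots> \<le> (\<Sum>y\<in>{..<n} - D. adj x y * - u $ y)"
      using y xy outflow[OF D(1) xy(1)] by (intro member_le_sum) auto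
    also have "\<dots> \<le> r D x"
      unfolding r_def using c deg_nonneg[OF x] by simp
    finally have "r D x > 0" .
    moreover have "\<alpha> D * r D x = 0"
      using Mv[OF D(1) xy(1)] eq tight x v by simp
    ultimately show False using D by simp
  qed
qed

end

theorem theorem4p2:
  fixes G :: "nat pair_pre_digraph" and n :: nat and \<omega> :: "(nat \<times> nat) weight_fun"
    and ev :: real and u :: "real vec"
  assumes "connected_weighted_graph G n \<omega>"
    and "eigenvector (modularity_mat G n \<omega>) u ev"
    and "degree_vec G n \<omega> \<bullet> u \<ge> 0"
    and "\<exists>i<n. \<exists>j<n. u $ i > 0 \<and> u $ j < 0"
  shows "card (positive_strong_nodal_domains G u)
           \<le> count_eigenvalues (modularity_mat G n \<omega>) (\<lambda>\<mu>. \<mu> \<ge> ev) + 1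
       \<and> card (positive_weak_nodal_domains G u)
           \<le> count_eigenvalues (modularity_mat G n \<omega>) (\<lambda>\<mu>. \<mu> > ev) + 1"
proof
  interpret connected_weighted_graph G n \<omega> by fact
  let ?P = "{i \<in> pverts G. u $ i > 0}" and ?W = "{i \<in> pverts G. u $ i \<ge> 0}"
  \<comment> \<open>Strong domains are nonempty and \<open>u\<close> is positive on them, so they fit the weak pattern.\<close>
  have "positive_strong_nodal_domains G u
      = {D \<in> components_verts (with_proj G \<restriction> ?P). \<exists>i\<in>D. u $ i \<noteq> 0}"
    unfolding positive_strong_nodal_domains_def
    using induced_component(1,2)[of ?P] by fastforce
  moreover have "card {D \<in> components_verts (with_proj G \<restriction> ?P). \<exists>i\<in>D. u $ i \<noteq> 0}
      \<le> count_eigenvalues (modularity_mat G n \<omega>) (\<lambda>\<mu>. \<mu> \<ge> ev) + 1"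
    by (rule nodal_domain_bound[OF assms(2,3)]) (auto simp: verts_eq)
  ultimately show "card (positive_strong_nodal_domains G u)
      \<le> count_eigenvalues (modularity_mat G n \<omega>) (\<lambda>\<mu>. \<mu> \<ge> ev) + 1"
    by simp
  obtain j where "j < n" "u $ j < 0"
    using assms(4) by auto
  then have "j \<in> pverts G - ?W"
    by (simp add: verts_eq)
  then have "?W \<noteq> pverts G" by blast
  then show "card (positive_weak_nodal_domains G u)
      \<le> count_eigenvalues (modularity_mat G n \<omega>) (\<lambda>\<mu>. \<mu> > ev) + 1"
    unfolding positive_weak_nodal_domains_def
    by (intro nodal_domain_bound[OF assms(2,3)]) (auto simp: verts_eq)
qed

end
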